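(* Let $w$ and $d$ be nonnegative integers. Let $H$ be a graph with treewidth at most $w$ and let $Q$ be a graph with maximum degree at most $d$. Then $H\boxtimes Q$ is conflict-free $((w+1)(d^2+d+2)-1)$-choosable.
   Context: All graphs are finite and simple. The strong product $A\boxtimes B$ has vertex set $V(A)\times V(B)$, with $(x_1,y_1)$ adjacent to $(x_2,y_2)$ iff either $x_1x_2\in E(A)$ and $y_1=y_2$, or $x_1=x_2$ and $y_1y_2\in E(B)$, or $x_1x_2\in E(A)$ and $y_1y_2\in E(B)$. For a real $k$, a $k$-list-assignment assigns each vertex $v$ a set $L(v)$ with $|L(v)|\ge k$; $G$ is conflict-free $k$-choosable if for every $k$-list-assignment $L$ there is a proper coloring $\phi$ with $\phi(v)\in L(v)$ for all $v$ such that every vertex $v$ with nonempty open neighbourhood $N_G(v)$ has some color appearing on exactly one vertex of $N_G(v)$. *)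

theory Defs
  imports Complex_Main "Graph_Theory.Graph_Theory"
begin

text \<open>Finite simple graphs are symmetric loop-free finite digraphs, locale \<^locale>\<open>pair_graph\<close>:
  an edge is the pair of arcs \<open>(u, v)\<close>, \<open>(v, u)\<close>.\<close>

definition nbhd :: "'a pair_pre_digraph \<Rightarrow> 'a \<Rightarrow> 'a set" where
  "nbhd G v = {u. v \<rightarrow>\<^bsub>with_proj G\<^esub> u}"

definition max_degree :: "'a pair_pre_digraph \<Rightarrow> nat" where
  "max_degree G = Max (insert 0 (out_degree (with_proj G) ` pverts G))"

definition strong_product ::
    "'a pair_pre_digraph \<Rightarrow> 'b pair_pre_digraph \<Rightarrow> ('a \<times> 'b) pair_pre_digraph"
    (infixl \<open>\<boxtimes>\<close> 70) where
  "A \<boxtimes> B = \<lparr> pverts = pverts A \<times> pverts B,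
     parcs = {((x1, y1), (x2, y2)) | x1 y1 x2 y2.
        x1 \<in> pverts A \<and> x2 \<in> pverts A \<and> y1 \<in> pverts B \<and> y2 \<in> pverts B \<and>
        ((x1, x2) \<in> parcs A \<and> y1 = y2 \<or>
         x1 = x2 \<and> (y1, y2) \<in> parcs B \<or>
         (x1, x2) \<in> parcs A \<and> (y1, y2) \<in> parcs B)} \<rparr>"

lemma pair_graph_strong_product:
  assumes "pair_graph A" and "pair_graph B"
  shows "pair_graph (A \<boxtimes> B)"
proof -
  interpret A: pair_graph A by fact
  interpret B: pair_graph B by fact
  have symA: "(y, x) \<in> parcs A" if "(x, y) \<in> parcs A" for x y
    using A.pair_sym_arcs that by (auto simp: symmetric_def dest: symD)
  have symB: "(y, x) \<in> parcs B" if "(x, y) \<in> parcs B" for x y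
    using B.pair_sym_arcs that by (auto simp: symmetric_def dest: symD)
  have "parcs (A \<boxtimes> B) \<subseteq> pverts (A \<boxtimes> B) \<times> pverts (A \<boxtimes> B)"
    by (auto simp: strong_product_def)
  moreover have "finite (pverts (A \<boxtimes> B))"
    by (simp add: strong_product_def A.pair_finite_verts B.pair_finite_verts)
  ultimately have "finite (parcs (A \<boxtimes> B))"
    by (meson finite_SigmaI finite_subset)
  with \<open>finite (pverts (A \<boxtimes> B))\<close> show ?thesis
    by unfold_locales
      (auto simp: strong_product_def symmetric_def intro!: symI
        dest: symA symB A.pair_no_loops B.pair_no_loops)
qed

text \<open>Every edge of a symmetric digraph is a directed cycle of length 2, so \<^const>\<open>forest\<close> and
  \<^const>\<open>tree\<close> do not describe undirected trees. The undirected cycles are the directed ones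
  of length at least 3.\<close>

definition undirected_tree :: "'a pair_pre_digraph \<Rightarrow> bool" where
  "undirected_tree T \<longleftrightarrow> pair_graph T \<and> Digraph_Component.connected (with_proj T) \<and>
     \<not> (\<exists>p. pre_digraph.cycle (with_proj T) p \<and> 3 \<le> length p)"

text \<open>Library connectedness includes nonemptiness, so the last condition below also says that
  every vertex lies in some bag.\<close>

definition tree_decomposition ::
    "'a pair_pre_digraph \<Rightarrow> 't pair_pre_digraph \<Rightarrow> ('t \<Rightarrow> 'a set) \<Rightarrow> bool" where
  "tree_decomposition G T B \<longleftrightarrow> undirected_tree T \<and>
     (\<forall>t \<in> pverts T. B t \<subseteq> pverts G) \<and>
     (\<forall>(u, v) \<in> parcs G. \<exists>t \<in> pverts T. u \<in> B t \<and> v \<in> B t) \<and>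
     (\<forall>v \<in> pverts G.
        Digraph_Component.connected (with_proj T \<restriction> {t \<in> pverts T. v \<in> B t}))"

text \<open>Truncated subtraction matters only for the null graph, whose width becomes 0 instead
  of \<open>-1\<close>.\<close>

definition decomposition_width :: "'t pair_pre_digraph \<Rightarrow> ('t \<Rightarrow> 'a set) \<Rightarrow> nat" where
  "decomposition_width T B = Max ((\<lambda>t. card (B t)) ` pverts T) - 1"

text \<open>Trees are finite, so up to isomorphism their nodes are natural numbers.\<close>

definition treewidth :: "'a pair_pre_digraph \<Rightarrow> nat" where
  "treewidth G = (LEAST k. \<exists>(T :: nat pair_pre_digraph) B.
     tree_decomposition G T B \<and> decomposition_width T B = k)"

lemma tree_decomposition_single_bag:
  assumes "pair_graph G"
  shows "tree_decomposition G \<lparr> pverts = {0 :: nat}, parcs = {} \<rparr> (\<lambda>_. pverts G)"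
proof -
  interpret G: pair_graph G by fact
  let ?T = "\<lparr> pverts = {0 :: nat}, parcs = {} \<rparr>"
  interpret T: pair_graph ?T
    by unfold_locales (auto simp: symmetric_def sym_def)
  have conn: "Digraph_Component.connected (with_proj ?T)"
    by (auto simp: Digraph_Component.connected_def strongly_connected_def mk_symmetric_def
        reachable_def)
  have eq: "with_proj ?T \<restriction> {0} = with_proj ?T"
    by (simp add: induce_subgraph_def with_proj_def)
  have "\<not> T.cycle p" for p
    by (auto simp: T.cycle_def T.awalk_def)
  moreover have "Digraph_Component.connected (with_proj ?T \<restriction> {0})"
    unfolding eq by (rule conn)
  ultimately show ?thesis
    using conn T.pair_graph
    by (auto simp: tree_decomposition_def undirected_tree_def dest: G.in_arcsD1 G.in_arcsD2)
qed

text \<open>Lists may be infinite; \<^const>\<open>card\<close> is 0 on infinite sets.\<close>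

definition list_assignment :: "real \<Rightarrow> 'a pair_pre_digraph \<Rightarrow> ('a \<Rightarrow> 'c set) \<Rightarrow> bool" where
  "list_assignment k G L \<longleftrightarrow> (\<forall>v \<in> pverts G. infinite (L v) \<or> k \<le> real (card (L v)))"

definition proper_coloring :: "'a pair_pre_digraph \<Rightarrow> ('a \<Rightarrow> 'c) \<Rightarrow> bool" where
  "proper_coloring G \<phi> \<longleftrightarrow> (\<forall>(u, v) \<in> parcs G. \<phi> u \<noteq> \<phi> v)"

definition conflict_free :: "'a pair_pre_digraph \<Rightarrow> ('a \<Rightarrow> 'c) \<Rightarrow> bool" where
  "conflict_free G \<phi> \<longleftrightarrow>
     (\<forall>v \<in> pverts G. nbhd G v \<noteq> {} \<longrightarrow> (\<exists>c. \<exists>!u. u \<in> nbhd G v \<and> \<phi> u = c))"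

text \<open>The type argument is the universe of colors; HOL cannot quantify over it inside the
  definition, so theorems should keep it schematic.\<close>

definition conflict_free_choosable :: "'c itself \<Rightarrow> real \<Rightarrow> 'a pair_pre_digraph \<Rightarrow> bool" where
  "conflict_free_choosable (_ :: 'c itself) k G \<longleftrightarrow>
     (\<forall>L :: 'a \<Rightarrow> 'c set. list_assignment k G L \<longrightarrow>
        (\<exists>\<phi>. proper_coloring G \<phi> \<and> (\<forall>v \<in> pverts G. \<phi> v \<in> L v) \<and> conflict_free G \<phi>))"

end

theory Submission
  imports Defs
begin

text \<open>Rank the nodes of a tree decomposition so that each has at most one neighbour of smaller
  rank, and order the vertices \<open>x\<close> of \<open>H\<close> by the smallest node \<open>top x\<close> whose bag contains \<open>x\<close>.
  The set \<open>E x\<close> of the smaller vertices in the bag of \<open>top x\<close> has at most \<open>w\<close> elements, contains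
  all smaller neighbours of \<open>x\<close>, and of any two of its elements the smaller one, \<open>z\<close>, lies in
  \<open>E y\<close> for the larger one \<open>y\<close>.

  Colour \<open>H \<boxtimes> Q\<close> greedily in an order that refines the one on \<open>H\<close>, and let \<open>s u\<close> be the first
  neighbour of \<open>u\<close>, whose colour is to be unique in the neighbourhood of \<open>u\<close>. The vertex
  \<open>v = (x, y)\<close> avoids the colours of all other earlier vertices in \<open>({x} \<union> E x) \<times> N\<^sup>2[y]\<close> and of
  all \<open>s u\<close> for \<open>u \<noteq> v\<close> in \<open>({x} \<union> E x) \<times> N[y]\<close>; these are at most
  \<open>(w+1)(d\<^sup>2+1) - 1 + (w+1)(d+1) - 1\<close> vertices. A neighbour \<open>u\<close> of \<open>v\<close> with larger
  first coordinate \<open>x'\<close> needs no further colours: the first coordinate of \<open>s u\<close> and \<open>x\<close> are both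
  in \<open>E x'\<close>, so that \<open>s u\<close> lies in the first of these two sets.\<close>

section \<open>Greedy list colouring\<close>

text \<open>By recursion along \<open>r\<close>: the colours forbidden at \<open>v\<close> lie in
  the image of \<open>F v\<close>, which is too small to cover \<open>L v\<close>. Since all of
  \<open>F v\<close> is counted, \<open>F v\<close> may also contain vertices that are not of
  smaller rank.\<close>

lemma greedy_list_coloring:
  fixes r :: "'a \<Rightarrow> nat" and L :: "'a \<Rightarrow> 'c set"
  assumes F: "\<And>v. v \<in> V \<Longrightarrow> finite (F v)"
    and L: "\<And>v. v \<in> V \<Longrightarrow> infinite (L v) \<or> card (F v) < card (L v)"
  obtains \<phi> where "\<And>v. v \<in> V \<Longrightarrow> \<phi> v \<in> L v"
    and "\<And>u v. v \<in> V \<Longrightarrow> u \<in> F v \<Longrightarrow> r u < r v \<Longrightarrow> \<phi> u \<noteq> \<phi> v"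
proof -
  \<comment> \<open>Dependent choice ranges over the whole type, so the guard
    \<open>v \<in> V\<close> makes the property trivially satisfiable elsewhere.\<close>
  let ?P = "\<lambda>f v c. v \<in> V \<longrightarrow> c \<in> L v \<and> (\<forall>u \<in> F v. r u < r v \<longrightarrow> f u \<noteq> c)"
  have "\<exists>\<phi>. \<forall>v. ?P \<phi> v (\<phi> v)"
  proof (rule dependent_wf_choice[OF wf_measure[of r]])
    show "?P f v c = ?P g v c" if "\<And>z. (z, v) \<in> measure r \<Longrightarrow> f z = g z" for f g v c
      using that by auto
  next
    fix v and f :: "'a \<Rightarrow> 'c"
    show "\<exists>c. ?P f v c"
    proof (cases "v \<in> V")
      case True
      have "\<not> L v \<subseteq> f ` F v"
      proof
        assume sub: "L v \<subseteq> f ` F v"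
        have fin: "finite (f ` F v)"
          using F[OF True] by simp
        have "card (L v) \<le> card (F v)"
          using card_mono[OF fin sub] card_image_le[OF F[OF True], of f] by linarith
        then show False
          using L[OF True] finite_subset[OF sub fin] by simp
      qed
      then show ?thesis by blast
    qed simp
  qed
  then show thesis using that by blast
qed

section \<open>Orderings of trees\<close>

lemma pawalk_verts_append_arc:
  "pcas a p s \<Longrightarrow> pawalk_verts a (p @ [(s, t)]) = pawalk_verts a p @ [t]"
  by (induction p arbitrary: a) auto

lemma pcas_append_arc:
  "pcas a p s \<Longrightarrow> pcas a (p @ [(s, t)]) t"
  by (induction p arbitrary: a) auto

text \<open>Without a crossing arc, membership in \<open>U\<close> would propagate along a walk from
  \<open>a\<close> to \<open>b\<close>. Connectedness refers to the symmetric closure, where arcs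
  may be traversed backwards, hence two alternatives.\<close>

lemma connected_crossing_arc:
  assumes conn: "Digraph_Component.connected G"
    and a: "a \<in> verts G" "a \<in> U" and b: "b \<in> verts G" "b \<notin> U"
  obtains e where "e \<in> arcs G" "tail G e \<in> U" "head G e \<notin> U"
    | e where "e \<in> arcs G" "head G e \<in> U" "tail G e \<notin> U"
proof (rule ccontr)
  assume *: "\<not> thesis"
  have "a \<rightarrow>\<^sup>*\<^bsub>with_proj (mk_symmetric G)\<^esub> b"
    using conn a b by (auto simp: Digraph_Component.connected_def strongly_connected_def)
  then have "(a, b) \<in> rtrancl_on (verts G) (parcs (mk_symmetric G))"
    by (simp add: reachable_def)
  then have "b \<in> U"
  proof (induction rule: rtrancl_on_induct)
    case base
    then show ?case using a by blast
  next
    case (step y z)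
    then show ?case
      using * that by (auto simp: parcs_mk_symmetric)
  qed
  with b show False by blast
qed

lemma connected_crossing_parc:
  assumes T: "pair_graph T" and conn: "Digraph_Component.connected (with_proj T \<restriction> A)"
    and a: "a \<in> A" "a \<in> U" and b: "b \<in> A" "b \<notin> U"
  obtains s t where "(s, t) \<in> parcs T" "s \<in> A \<inter> U" "t \<in> A - U"
proof -
  interpret T: pair_graph T by fact
  have sym: "(y, x) \<in> parcs T" if "(x, y) \<in> parcs T" for x y
    using T.pair_sym_arcs that by (auto simp: symmetric_def dest: symD)
  show thesis
    by (rule connected_crossing_arc[OF conn, of a U b]) (use a b that in \<open>auto dest: sym\<close>)
qed

text \<open>The tree is exhausted by adding one node at a time. The added node has only one neighbour
  among the previous ones: a simple path between two of them would close up to a cycle.\<close>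

lemma undirected_tree_ordering:
  assumes "undirected_tree T"
  obtains f :: "'t \<Rightarrow> nat" where "inj_on f (pverts T)"
    and "\<And>a b c. (a, c) \<in> parcs T \<Longrightarrow> (b, c) \<in> parcs T \<Longrightarrow> f a < f c \<Longrightarrow> f b < f c \<Longrightarrow> a = b"
proof -
  from assms have "pair_graph T" and conn: "Digraph_Component.connected (with_proj T)"
    and acyclic: "\<And>p. pre_digraph.cycle (with_proj T) p \<Longrightarrow> length p < 3"
    unfolding undirected_tree_def by (auto simp: not_le)
  interpret T: pair_graph T by fact
  have sym: "(y, x) \<in> parcs T" if "(x, y) \<in> parcs T" for x y
    using T.pair_sym_arcs that by (auto simp: symmetric_def dest: symD)
  have restrict: "with_proj T \<restriction> pverts T = with_proj T"
    by (auto simp: induce_subgraph_def with_proj_def dest: T.in_arcsD1 T.in_arcsD2)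
  define path where "path S a p b \<longleftrightarrow> set p \<subseteq> parcs T \<and> pcas a p b \<and>
    distinct (pawalk_verts a p) \<and> set (pawalk_verts a p) \<subseteq> S" for S a p b
  \<comment> \<open>The invariant of the growing node set \<open>S\<close>. Simple paths inside
    \<open>S\<close> belong to it because they supply the cycle that rules out a second neighbour of
    a new node.\<close>
  define good where "good S f \<longleftrightarrow> S \<subseteq> pverts T \<and> inj_on f S \<and>
    (\<forall>a \<in> S. \<forall>b \<in> S. \<exists>p. path S a p b) \<and>
    (\<forall>a \<in> S. \<forall>b \<in> S. \<forall>c \<in> S. (a, c) \<in> parcs T \<longrightarrow> (b, c) \<in> parcs T \<longrightarrow>
      f a < f c \<longrightarrow> f b < f c \<longrightarrow> a = b)" for S and f :: "'t \<Rightarrow> nat"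
  obtain r where r: "r \<in> pverts T"
    using conn by (auto simp: Digraph_Component.connected_def strongly_connected_def)
  have "\<exists>S f. good S f \<and> card S = Suc n" if "Suc n \<le> card (pverts T)" for n
    using that
  proof (induction n)
    case 0
    have "path {r} r [] r"
      by (simp add: path_def)
    then have "good {r} (\<lambda>_. 0)"
      using r by (auto simp: good_def)
    then show ?case by (intro exI[of _ "{r}"]) auto
  next
    case (Suc n)
    then obtain S f where good: "good S f" and card: "card S = Suc n" by auto
    have sub: "S \<subseteq> pverts T" using good by (simp add: good_def)
    then have fin: "finite S" using T.pair_finite_verts finite_subset by blast
    have "S \<noteq> pverts T" using card Suc.prems by auto
    then obtain b where b: "b \<in> pverts T" "b \<notin> S" using sub by blast
    obtain a where a: "a \<in> S" using card by fastforce
    obtain s t where st: "(s, t) \<in> parcs T" "s \<in> S" "t \<in> pverts T" "t \<notin> S"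
      by (rule connected_crossing_parc[OF \<open>pair_graph T\<close>, of "pverts T" a S b])
        (use conn a b sub in \<open>auto simp: restrict\<close>)
    \<comment> \<open>The new node outranks all of \<open>S\<close>, so no old node gains a
      neighbour of smaller rank.\<close>
    define g where "g = f(t := Suc (Max (f ` S)))"
    have g_S: "g x = f x" if "x \<in> S" for x
      using that st by (auto simp: g_def)
    have g_less: "g x < g t" if "x \<in> S" for x
      using that st fin by (auto simp: g_def less_Suc_eq_le)
    have paths: "\<exists>p. path S a p b" if "a \<in> S" "b \<in> S" for a b
      using good that by (auto simp: good_def)
    have uniq: "a = s" if a: "a \<in> S" "(a, t) \<in> parcs T" for a
    proof (rule ccontr)
      assume "a \<noteq> s"
      obtain p where p: "path S s p a" using paths st a by blast
      let ?c = "(t, s) # p @ [(a, t)]"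
      \<comment> \<open>This lifts the closed walk to three arcs; shorter cycles, which go back and
        forth along an edge, are not excluded by \<open>acyclic\<close>.\<close>
      have "p \<noteq> []" using p \<open>a \<noteq> s\<close> by (auto simp: path_def)
      then have "3 \<le> length ?c" by (cases p) auto
      moreover have "T.cycle ?c"
        unfolding T.cycle_def
      proof (intro exI conjI)
        show "T.awalk t ?c t"
          using p st a sym[OF st(1)] pcas_append_arc[of s p a t]
          unfolding T.awalk_def path_def by simp
        show "distinct (tl (pawalk_verts t ?c))"
          using p st by (auto simp: path_def pawalk_verts_append_arc)
      qed simp
      ultimately show False using acyclic[of ?c] by simp
    qed
    have "\<exists>p. path (insert t S) a p b" if ab: "a \<in> insert t S" "b \<in> insert t S" for a b
    proof -
      consider "a = t" "b = t" | "a \<in> S" "b \<in> S" | "a = t" "b \<in> S" | "a \<in> S" "b = t"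
        using ab by blast
      then show ?thesis
      proof cases
        case 1
        then have "path (insert t S) a [] b" by (simp add: path_def)
        then show ?thesis by blast
      next
        case 2
        then show ?thesis using paths[of a b] by (auto simp: path_def)
      next
        case 3
        then obtain p where "path S s p b" using paths st by blast
        then have "path (insert t S) a ((t, s) # p) b"
          using st 3 sym by (auto simp: path_def)
        then show ?thesis by blast
      next
        case 4
        then obtain p where "path S a p s" using paths st by blast
        then have "path (insert t S) a (p @ [(s, t)]) b"
          using st 4 pcas_append_arc[of a p s t] pawalk_verts_append_arc[of a p s t]
          unfolding path_def by (simp add: subset_insertI2) blast
        then show ?thesis by blast
      qed
    qed
    moreover have "inj_on g (insert t S)"
    proof -
      have "inj_on g S"
        using good g_S by (auto simp: good_def inj_on_def)
      then show ?thesis using g_less by (force simp: inj_on_def)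
    qed
    moreover have "a = b" if "a \<in> insert t S" "b \<in> insert t S" "c \<in> insert t S"
      "(a, c) \<in> parcs T" "(b, c) \<in> parcs T" "g a < g c" "g b < g c" for a b c
    proof (cases "c = t")
      case True
      then show ?thesis using that uniq by auto
    next
      case False
      then have "a \<noteq> t" "b \<noteq> t" using that g_less[of c] by auto
      then show ?thesis using that False good by (auto simp: g_S good_def)
    qed
    ultimately have "good (insert t S) g"
      unfolding good_def using sub st(3) by (intro conjI ballI impI) blast+
    then show ?case using card fin st by (intro exI[of _ "insert t S"]) auto
  qed
  moreover have "card (pverts T) \<noteq> 0" using r T.pair_finite_verts by auto
  ultimately obtain S f where good: "good S f" and "card S = card (pverts T)"
    by (metis le_refl not0_implies_Suc)
  then have "S = pverts T"
    using card_subset_eq[OF T.pair_finite_verts] by (auto simp: good_def)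
  with good have "inj_on f (pverts T)" and
    "\<forall>a \<in> pverts T. \<forall>b \<in> pverts T. \<forall>c \<in> pverts T. (a, c) \<in> parcs T \<longrightarrow> (b, c) \<in> parcs T \<longrightarrow>
      f a < f c \<longrightarrow> f b < f c \<longrightarrow> a = b"
    unfolding good_def by auto
  then show thesis
    by (intro that[of f]) (auto dest: T.in_arcsD1 T.in_arcsD2)
qed

text \<open>The set \<open>D\<close> of the descendants of \<open>t\<close> can only be left through the parent of \<open>t\<close>.\<close>

lemma connected_subset_contains_parent:
  fixes f :: "'t \<Rightarrow> nat"
  assumes T: "pair_graph T" and conn: "Digraph_Component.connected (with_proj T \<restriction> A)"
    and inj: "inj_on f (pverts T)"
    and uniq: "\<And>a b c. (a, c) \<in> parcs T \<Longrightarrow> (b, c) \<in> parcs T \<Longrightarrow> f a < f c \<Longrightarrow> f b < f c \<Longrightarrow> a = b"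
    and t: "t \<in> A" and s: "s \<in> A" "f s < f t"
  obtains p where "(p, t) \<in> parcs T" "f p < f t" "p \<in> A"
proof -
  interpret T: pair_graph T by fact
  have sym: "(y, x) \<in> parcs T" if "(x, y) \<in> parcs T" for x y
    using T.pair_sym_arcs that by (auto simp: symmetric_def dest: symD)
  \<comment> \<open>\<open>R\<close> consists of the arcs from parent to child.\<close>
  define R where "R = {(a, b). (a, b) \<in> parcs T \<and> f a < f b}"
  define D where "D = {a. (t, a) \<in> R\<^sup>*}"
  have "f t \<le> f a" if "a \<in> D" for a
  proof -
    have "(t, a) \<in> R\<^sup>*" using that by (simp add: D_def)
    then show ?thesis by induction (auto simp: R_def)
  qed
  then have "s \<notin> D" using s by fastforce
  have "t \<in> D" by (simp add: D_def)
  obtain a b where ab: "(a, b) \<in> parcs T" "a \<in> A \<inter> D" "b \<in> A - D"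
    using connected_crossing_parc[OF T conn t \<open>t \<in> D\<close> s(1) \<open>s \<notin> D\<close>] by blast
  \<comment> \<open>An arc that increases the rank stays inside \<open>D\<close>, so the arc leaving
    \<open>D\<close> leads from \<open>a\<close> to its parent \<open>b\<close>.\<close>
  have "(a, b) \<notin> R"
    using ab by (auto simp: D_def dest: rtrancl_into_rtrancl)
  then have "f b \<le> f a" using ab by (auto simp: R_def)
  moreover have "a \<in> pverts T" "b \<in> pverts T" "a \<noteq> b"
    using ab T.in_arcsD1 T.in_arcsD2 by auto
  ultimately have less: "f b < f a"
    using inj by (metis inj_on_def le_neq_implies_less)
  \<comment> \<open>Any other descendant has its parent in \<open>D\<close>, whereas the unique
    parent \<open>b\<close> of \<open>a\<close> is outside.\<close>
  have "a = t"
  proof (rule ccontr)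
    assume "a \<noteq> t"
    then obtain c where "(t, c) \<in> R\<^sup>*" "(c, a) \<in> R"
      using ab by (auto simp: D_def elim: rtranclE)
    then have "c = b" using uniq[of c a b] ab less sym by (auto simp: R_def)
    with \<open>(t, c) \<in> R\<^sup>*\<close> show False using ab by (auto simp: D_def)
  qed
  then show thesis using that[of b] ab less sym by auto
qed

section \<open>Elimination orderings from tree decompositions\<close>

text \<open>The minimum is attained since a single-bag decomposition exists. \<open>Suc w\<close>
  undoes the subtraction of 1 in the width; finiteness is recorded because \<open>card\<close> is 0
  on infinite sets.\<close>

lemma treewidth_decomposition:
  assumes H: "pair_graph H" and tw: "treewidth H \<le> w"
  obtains T :: "nat pair_pre_digraph" and B where "tree_decomposition H T B"
    and "\<And>t. t \<in> pverts T \<Longrightarrow> finite (B t) \<and> card (B t) \<le> Suc w"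
proof -
  have "\<exists>(T :: nat pair_pre_digraph) B.
     tree_decomposition H T B \<and> decomposition_width T B = treewidth H"
    unfolding treewidth_def
    by (rule LeastI_ex) (use tree_decomposition_single_bag[OF H] in blast)
  then obtain T :: "nat pair_pre_digraph" and B where
    TB: "tree_decomposition H T B" and width: "decomposition_width T B \<le> w"
    using tw by auto
  have "finite (pverts T)" "finite (pverts H)"
    using TB H pair_fin_digraph.pair_finite_verts
    by (auto simp: tree_decomposition_def undirected_tree_def pair_graph_def pair_digraph_def)
  have "finite (B t) \<and> card (B t) \<le> Suc w" if "t \<in> pverts T" for t
  proof
    show "finite (B t)"
      using TB that \<open>finite (pverts H)\<close> finite_subset by (auto simp: tree_decomposition_def)
    have "card (B t) \<le> Max ((\<lambda>t. card (B t)) ` pverts T)"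
      using that \<open>finite (pverts T)\<close> by (intro Max_ge) auto
    then show "card (B t) \<le> Suc w" using width by (simp add: decomposition_width_def)
  qed
  then show thesis using TB that by blast
qed

text \<open>This encodes lexicographic orders by natural numbers; the orders \<open>r\<close> on
  \<open>H\<close> and \<open>\<rho>\<close> on the product are built this way.\<close>

lemma less_mult_add_iff:
  fixes a b i j N :: nat
  assumes "i < N" "j < N"
  shows "a * N + i < b * N + j \<longleftrightarrow> a < b \<or> a = b \<and> i < j"
proof -
  have "x * N + k < y * N + l" if "x < y" "k < N" for x y k l
  proof -
    have "x * N + k < Suc x * N" using that by simp
    also have "\<dots> \<le> y * N" using that by (intro mult_right_mono) auto
    finally show ?thesis by simp
  qed
  from this[of a b i j] this[of b a j i] assms show ?thesis
    by (cases a b rule: linorder_cases) auto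
qed

text \<open>A perfect elimination ordering of a chordal supergraph of \<open>H\<close>: joining
  every \<open>x\<close> to \<open>E x\<close> turns each \<open>E x\<close> into a clique.\<close>

lemma elimination_ordering:
  assumes H: "pair_graph H" and tw: "treewidth H \<le> w"
  obtains r :: "'a \<Rightarrow> nat" and E where "inj_on r (pverts H)"
    and "\<And>x. x \<in> pverts H \<Longrightarrow> finite (E x) \<and> card (E x) \<le> w"
    and "\<And>x y. (x, y) \<in> parcs H \<Longrightarrow> r y < r x \<Longrightarrow> y \<in> E x"
    and "\<And>x y z. x \<in> pverts H \<Longrightarrow> y \<in> E x \<Longrightarrow> z \<in> E x \<Longrightarrow> r z < r y \<Longrightarrow> z \<in> E y"
proof -
  interpret H: pair_graph H by fact
  obtain T :: "nat pair_pre_digraph" and B where TB: "tree_decomposition H T B"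
    and card_B: "\<And>t. t \<in> pverts T \<Longrightarrow> finite (B t) \<and> card (B t) \<le> Suc w"
    using treewidth_decomposition[OF H tw] by blast
  then have T: "undirected_tree T" and B_sub: "\<And>t. t \<in> pverts T \<Longrightarrow> B t \<subseteq> pverts H"
    and B_arc: "\<And>x y. (x, y) \<in> parcs H \<Longrightarrow> \<exists>t \<in> pverts T. x \<in> B t \<and> y \<in> B t"
    and B_conn: "\<And>x. x \<in> pverts H \<Longrightarrow>
        Digraph_Component.connected (with_proj T \<restriction> {t \<in> pverts T. x \<in> B t})"
    by (auto simp: tree_decomposition_def)
  have "pair_graph T" using T by (simp add: undirected_tree_def)
  obtain f :: "nat \<Rightarrow> nat" where inj: "inj_on f (pverts T)"
    and uniq: "\<And>a b c. (a, c) \<in> parcs T \<Longrightarrow> (b, c) \<in> parcs T \<Longrightarrow> f a < f c \<Longrightarrow> f b < f c \<Longrightarrow> a = b"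
    using undirected_tree_ordering[OF T] by blast
  define top where "top x = (ARG_MIN f t. t \<in> pverts T \<and> x \<in> B t)" for x
  have top: "top x \<in> pverts T" "x \<in> B (top x)"
    and top_le: "\<And>t. t \<in> pverts T \<Longrightarrow> x \<in> B t \<Longrightarrow> f (top x) \<le> f t" if x: "x \<in> pverts H" for x
  proof -
    obtain t where "t \<in> pverts T \<and> x \<in> B t"
      using B_conn[OF x] by (auto simp: Digraph_Component.connected_def strongly_connected_def)
    from arg_min_nat_lemma[of "\<lambda>t. t \<in> pverts T \<and> x \<in> B t", OF this, of f]
    show "top x \<in> pverts T" "x \<in> B (top x)"
      "\<And>t. t \<in> pverts T \<Longrightarrow> x \<in> B t \<Longrightarrow> f (top x) \<le> f t"
      by (auto simp: top_def)
  qed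
  have parent: "\<exists>p \<in> pverts T. (p, t) \<in> parcs T \<and> f p < f t \<and> x \<in> B p"
    if "x \<in> pverts H" "t \<in> pverts T" "x \<in> B t" "f (top x) < f t" for x t
    by (rule connected_subset_contains_parent[OF \<open>pair_graph T\<close> B_conn[OF that(1)] inj uniq,
          where t = t and s = "top x"])
      (use that top[OF that(1)] in auto)
  \<comment> \<open>Move from \<open>t\<close> towards the root. As long as \<open>top y\<close> is
    not reached, both \<open>x\<close> and \<open>y\<close> occur at a smaller node, so the unique
    parent of the current node still contains both.\<close>
  have common: "x \<in> B (top y)"
    if "t \<in> pverts T" "x \<in> B t" "y \<in> B t" "f (top x) \<le> f (top y)" for x y t
    using that
  proof (induction "f t" arbitrary: t rule: less_induct)
    case less
    have xy: "x \<in> pverts H" "y \<in> pverts H" using less.prems B_sub by blast+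
    show ?case
    proof (cases "t = top y")
      case True
      then show ?thesis using less by simp
    next
      case False
      then have lt: "f (top y) < f t"
        using top[of y] top_le[of y t] xy less.prems inj
        by (metis inj_on_def le_neq_implies_less)
      obtain p where p: "p \<in> pverts T" "(p, t) \<in> parcs T" "f p < f t" "y \<in> B p"
        using parent[of y t] lt less.prems xy by blast
      obtain q where q: "(q, t) \<in> parcs T" "f q < f t" "x \<in> B q"
        using parent[of x t] lt less.prems xy by auto
      have "p = q" using uniq p q by blast
      then show ?thesis using less.hyps[of p] p q less.prems by blast
    qed
  qed
  obtain h where h: "bij_betw h (pverts H) {0..<card (pverts H)}"
    using ex_bij_betw_finite_nat[OF H.pair_finite_verts] by blast
  let ?N = "card (pverts H)"
  have h_less: "h x < ?N" if "x \<in> pverts H" for x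
    using h that by (auto simp: bij_betw_def)
  \<comment> \<open>The arbitrary enumeration \<open>h\<close> breaks ties between vertices with the
    same top node.\<close>
  define r where "r x = f (top x) * ?N + h x" for x
  define E where "E x = {y \<in> B (top x). r y < r x}" for x
  have r_less: "r x < r y \<longleftrightarrow> f (top x) < f (top y) \<or> f (top x) = f (top y) \<and> h x < h y"
    if "x \<in> pverts H" "y \<in> pverts H" for x y
    unfolding r_def using that by (intro less_mult_add_iff h_less)
  have E_I: "y \<in> E x" if "t \<in> pverts T" "x \<in> B t" "y \<in> B t" "r y < r x" for t x y
  proof -
    have "x \<in> pverts H" "y \<in> pverts H" using that B_sub by blast+
    then have "f (top y) \<le> f (top x)" using that r_less[of y x] by linarith
    then show ?thesis using common that by (auto simp: E_def)
  qed
  show thesis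
  proof (rule that[of r E])
    show "inj_on r (pverts H)"
    proof (rule inj_onI)
      fix x y assume xy: "x \<in> pverts H" "y \<in> pverts H" "r x = r y"
      then have "h x = h y"
        using r_less[of x y] r_less[of y x] by linarith
      then show "x = y" using xy h by (auto simp: bij_betw_def inj_on_def)
    qed
  next
    fix x assume x: "x \<in> pverts H"
    \<comment> \<open>\<open>x\<close> lies in its own top bag but not in \<open>E x\<close>, which
      lowers the bound from \<open>Suc w\<close> to \<open>w\<close>.\<close>
    have "E x \<subseteq> B (top x) - {x}" by (auto simp: E_def)
    moreover have "card (B (top x) - {x}) \<le> w" "finite (B (top x) - {x})"
      using card_B[of "top x"] top[OF x] by auto
    ultimately show "finite (E x) \<and> card (E x) \<le> w"
      by (meson card_mono dual_order.trans finite_subset)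
  next
    fix x y assume "(x, y) \<in> parcs H" "r y < r x"
    then show "y \<in> E x" using B_arc E_I by blast
  next
    fix x y z assume "x \<in> pverts H" "y \<in> E x" "z \<in> E x" "r z < r y"
    then show "z \<in> E y" using E_I[of "top x" y z] top[of x] by (auto simp: E_def)
  qed
qed

section \<open>Neighbourhoods\<close>

lemma in_nbhd_iff [simp]: "u \<in> nbhd G v \<longleftrightarrow> (v, u) \<in> parcs G"
  by (simp add: nbhd_def)

lemma card_nbhd_le_max_degree:
  assumes "pair_graph G" and v: "v \<in> pverts G"
  shows "finite (nbhd G v)" and "card (nbhd G v) \<le> max_degree G"
proof -
  interpret G: pair_graph G by fact
  have fin: "finite (out_arcs (with_proj G) v)"
    using G.pair_finite_arcs by (auto simp: out_arcs_def)
  have eq: "nbhd G v = snd ` out_arcs (with_proj G) v"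
    by (force simp: out_arcs_def)
  show "finite (nbhd G v)" using fin eq by simp
  have "card (nbhd G v) \<le> out_degree (with_proj G) v"
    unfolding eq out_degree_def by (rule card_image_le[OF fin])
  also have "\<dots> \<le> max_degree G"
    unfolding max_degree_def using v G.pair_finite_verts by (intro Max_ge) auto
  finally show "card (nbhd G v) \<le> max_degree G" .
qed

definition closed_nbhd :: "'a pair_pre_digraph \<Rightarrow> 'a \<Rightarrow> 'a set" where
  "closed_nbhd G v = insert v (nbhd G v)"

lemma card_closed_nbhd:
  assumes "pair_graph G" "max_degree G \<le> d" "v \<in> pverts G"
  shows "finite (closed_nbhd G v)" and "card (closed_nbhd G v) \<le> d + 1"
  using card_nbhd_le_max_degree[OF assms(1,3)] assms(2)
  by (auto simp: closed_nbhd_def card_insert_if)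

text \<open>Each of the at most \<open>d\<close> neighbours of \<open>v\<close> has \<open>v\<close>
  among its own neighbours, so it contributes itself and at most \<open>d - 1\<close> further
  vertices; \<open>v\<close> is counted once.\<close>

lemma card_second_closed_nbhd:
  assumes G: "pair_graph G" and d: "max_degree G \<le> d" and v: "v \<in> pverts G"
  shows "finite (\<Union>u \<in> closed_nbhd G v. closed_nbhd G u)"
    and "card (\<Union>u \<in> closed_nbhd G v. closed_nbhd G u) \<le> d\<^sup>2 + 1"
proof -
  interpret G: pair_graph G by fact
  have sym: "(y, x) \<in> parcs G" if "(x, y) \<in> parcs G" for x y
    using G.pair_sym_arcs that by (auto simp: symmetric_def dest: symD)
  have nbhd: "finite (nbhd G u)" "card (nbhd G u) \<le> d" if "u \<in> pverts G" for u
    using card_nbhd_le_max_degree[OF G that] d by auto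
  let ?W = "\<lambda>u. insert u (nbhd G u - {v})"
  have W: "finite (?W u)" "card (?W u) \<le> d" if "u \<in> nbhd G v" for u
  proof -
    have u: "u \<in> pverts G" "v \<in> nbhd G u"
      using that sym G.in_arcsD2 by auto
    show "finite (?W u)" using nbhd u by simp
    have "card (nbhd G u) > 0" using nbhd(1)[OF u(1)] u(2) by (auto simp: card_gt_0_iff)
    then have "card (nbhd G u - {v}) < d"
      using nbhd[OF u(1)] u(2) by (simp add: card_Diff_singleton)
    then show "card (?W u) \<le> d"
      using nbhd(1)[OF u(1)] by (auto simp: card_insert_if)
  qed
  have sub: "(\<Union>u \<in> closed_nbhd G v. closed_nbhd G u) \<subseteq> insert v (\<Union>u \<in> nbhd G v. ?W u)"
    by (auto simp: closed_nbhd_def)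
  have fin: "finite (insert v (\<Union>u \<in> nbhd G v. ?W u))"
    by (intro finite.insertI finite_UN_I nbhd(1)[OF v] W(1))
  show "finite (\<Union>u \<in> closed_nbhd G v. closed_nbhd G u)"
    using finite_subset[OF sub fin] .
  have "card (\<Union>u \<in> nbhd G v. ?W u) \<le> (\<Sum>u \<in> nbhd G v. card (?W u))"
    by (rule card_UN_le[OF nbhd(1)[OF v]])
  also have "\<dots> \<le> card (nbhd G v) * d"
    using sum_bounded_above[of "nbhd G v" "\<lambda>u. card (?W u)" d] W(2) by simp
  also have "\<dots> \<le> d\<^sup>2"
    using nbhd(2)[OF v] by (simp add: power2_eq_square)
  finally have "card (insert v (\<Union>u \<in> nbhd G v. ?W u)) \<le> d\<^sup>2 + 1"
    using card_insert_le_m1[of "d\<^sup>2 + 1" "\<Union>u \<in> nbhd G v. ?W u" v] by simp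
  then show "card (\<Union>u \<in> closed_nbhd G v. closed_nbhd G u) \<le> d\<^sup>2 + 1"
    using card_mono[OF fin sub] by linarith
qed

section \<open>Strong products and their conflict-free colouring\<close>

lemma strong_product_arcD:
  assumes "((x, y), (x', y')) \<in> parcs (A \<boxtimes> B)"
  shows "x = x' \<or> (x, x') \<in> parcs A" and "y' \<in> closed_nbhd B y"
  using assms by (auto simp: strong_product_def closed_nbhd_def)

lemma card_Times_minus_point:
  assumes "finite X" "card X \<le> m" "finite Y" "card Y \<le> n" "x \<in> X" "y \<in> Y"
  shows "card (X \<times> Y - {(x, y)}) < m * n"
proof -
  have "card (X \<times> Y - {(x, y)}) < card (X \<times> Y)"
    using assms by (intro card_Diff1_less) auto
  also have "\<dots> \<le> m * n"
    using assms by (simp add: card_cartesian_product mult_le_mono)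
  finally show ?thesis .
qed

theorem theorem5p3:
  fixes H :: "'a pair_pre_digraph" and Q :: "'b pair_pre_digraph" and w d :: nat
  assumes "pair_graph H" and "treewidth H \<le> w"
    and "pair_graph Q" and "max_degree Q \<le> d"
  shows "conflict_free_choosable TYPE('c)
    ((real w + 1) * ((real d)\<^sup>2 + real d + 2) - 1) (H \<boxtimes> Q)"
  unfolding conflict_free_choosable_def
proof (intro allI impI)
  fix L :: "'a \<times> 'b \<Rightarrow> 'c set"
  assume L: "list_assignment ((real w + 1) * ((real d)\<^sup>2 + real d + 2) - 1) (H \<boxtimes> Q) L"
  let ?G = "H \<boxtimes> Q"
  interpret H: pair_graph H by fact
  interpret Q: pair_graph Q by fact
  interpret G: pair_graph ?G using assms by (simp add: pair_graph_strong_product)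
  have symG: "(v, u) \<in> parcs ?G" if "(u, v) \<in> parcs ?G" for u v
    using G.pair_sym_arcs that by (auto simp: symmetric_def dest: symD)
  have verts_G: "pverts ?G = pverts H \<times> pverts Q" by (simp add: strong_product_def)
  obtain r :: "'a \<Rightarrow> nat" and E where inj_r: "inj_on r (pverts H)"
    and E: "\<And>x. x \<in> pverts H \<Longrightarrow> finite (E x) \<and> card (E x) \<le> w"
    and E_nbr: "\<And>x y. (x, y) \<in> parcs H \<Longrightarrow> r y < r x \<Longrightarrow> y \<in> E x"
    and E_trans: "\<And>x y z. x \<in> pverts H \<Longrightarrow> y \<in> E x \<Longrightarrow> z \<in> E x \<Longrightarrow> r z < r y \<Longrightarrow> z \<in> E y"
    using elimination_ordering[OF assms(1,2)] by blast
  obtain h where h: "bij_betw h (pverts Q) {0..<card (pverts Q)}"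
    using ex_bij_betw_finite_nat[OF Q.pair_finite_verts] by blast
  define \<rho> where "\<rho> v = r (fst v) * card (pverts Q) + h (snd v)" for v
  have h_less: "h y < card (pverts Q)" if "y \<in> pverts Q" for y
    using h that by (auto simp: bij_betw_def)
  have \<rho>_less: "\<rho> u < \<rho> v \<longleftrightarrow> r (fst u) < r (fst v) \<or> r (fst u) = r (fst v) \<and> h (snd u) < h (snd v)"
    if "u \<in> pverts ?G" "v \<in> pverts ?G" for u v
    unfolding \<rho>_def using that by (intro less_mult_add_iff h_less) (auto simp: verts_G)
  have \<rho>_neq: "\<rho> u < \<rho> v \<or> \<rho> v < \<rho> u" if "u \<in> pverts ?G" "v \<in> pverts ?G" "u \<noteq> v" for u v
  proof (rule ccontr)
    assume "\<not> ?thesis"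
    then have "r (fst u) = r (fst v)" "h (snd u) = h (snd v)"
      using \<rho>_less[OF that(1,2)] \<rho>_less[OF that(2,1)] by linarith+
    moreover have "fst u \<in> pverts H" "fst v \<in> pverts H" "snd u \<in> pverts Q" "snd v \<in> pverts Q"
      using that by (auto simp: verts_G)
    ultimately have "fst u = fst v" "snd u = snd v"
      using inj_onD[OF inj_r] inj_onD[OF bij_betw_imp_inj_on[OF h]] by blast+
    with that(3) show False by (simp add: prod_eq_iff)
  qed
  \<comment> \<open>For an isolated \<open>u\<close> the value is unspecified; this costs at most
    one forbidden colour that the count includes anyway.\<close>
  define s where "s u = (ARG_MIN \<rho> v. v \<in> nbhd ?G u)" for u
  have s: "s u \<in> nbhd ?G u" "\<rho> (s u) \<le> \<rho> v" if "v \<in> nbhd ?G u" for u v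
    using arg_min_nat_lemma[of "\<lambda>v. v \<in> nbhd ?G u" v \<rho>, OF that] by (simp_all only: s_def that)
  let ?X = "\<lambda>x. insert x (E x)"
  let ?N2 = "\<lambda>y. \<Union>z \<in> closed_nbhd Q y. closed_nbhd Q z"
  define F where "F v = (?X (fst v) \<times> ?N2 (snd v) - {v}) \<union>
    s ` (?X (fst v) \<times> closed_nbhd Q (snd v) - {v})" for v
  \<comment> \<open>Both products omit the point \<open>v\<close>, which saves 2. One unit is the
    \<open>- 1\<close> in the list size, the other gives the strict inequality that the greedy
    colouring requires.\<close>
  have F: "finite (F v)" "card (F v) + 2 \<le> (w + 1) * (d\<^sup>2 + 1) + (w + 1) * (d + 1)"
    if "v \<in> pverts ?G" for v
  proof -
    obtain x y where v: "v = (x, y)" by (cases v)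
    then have xy: "x \<in> pverts H" "y \<in> pverts Q" using that verts_G by auto
    have X: "finite (?X x)" "card (?X x) \<le> w + 1"
      using E[OF xy(1)] by (auto simp: card_insert_if)
    note N = card_closed_nbhd[OF assms(3,4) xy(2)]
    note N2 = card_second_closed_nbhd[OF assms(3,4) xy(2)]
    let ?A = "?X x \<times> ?N2 y - {(x, y)}" and ?B = "?X x \<times> closed_nbhd Q y - {(x, y)}"
    have fin: "finite ?A" "finite ?B"
      by (intro finite_Diff finite_cartesian_product X(1) N(1) N2(1))+
    have eq: "F v = ?A \<union> s ` ?B" by (simp add: F_def v)
    show "finite (F v)" unfolding eq using fin by blast
    have "card ?A < (w + 1) * (d\<^sup>2 + 1)"
      by (intro card_Times_minus_point X N2) (auto simp: closed_nbhd_def)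
    moreover have "card ?B < (w + 1) * (d + 1)"
      by (intro card_Times_minus_point X N) (auto simp: closed_nbhd_def)
    moreover have "card (F v) \<le> card ?A + card ?B"
      unfolding eq using card_Un_le[of ?A "s ` ?B"] card_image_le[OF fin(2), of s] by linarith
    ultimately show "card (F v) + 2 \<le> (w + 1) * (d\<^sup>2 + 1) + (w + 1) * (d + 1)"
      by linarith
  qed
  have L_large: "infinite (L v) \<or> card (F v) < card (L v)" if "v \<in> pverts ?G" for v
  proof -
    have "real (card (F v) + 2) \<le> real ((w + 1) * (d\<^sup>2 + 1) + (w + 1) * (d + 1))"
      using F(2)[OF that] of_nat_le_iff by blast
    also have "\<dots> = (real w + 1) * ((real d)\<^sup>2 + real d + 2)"
      by (simp add: algebra_simps)
    finally have "real (card (F v)) < (real w + 1) * ((real d)\<^sup>2 + real d + 2) - 1"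
      by simp
    then show ?thesis using L that unfolding list_assignment_def by fastforce
  qed
  obtain \<phi> where \<phi>_L: "\<And>v. v \<in> pverts ?G \<Longrightarrow> \<phi> v \<in> L v"
    and \<phi>_F: "\<And>u v. v \<in> pverts ?G \<Longrightarrow> u \<in> F v \<Longrightarrow> \<rho> u < \<rho> v \<Longrightarrow> \<phi> u \<noteq> \<phi> v"
    using greedy_list_coloring[of "pverts ?G" F L \<rho>] F(1) L_large by blast
  have nbr_X: "x' \<in> ?X x" if "((x, y), (x', y')) \<in> parcs ?G" "r x' \<le> r x" for x y x' y'
  proof (cases "x = x'")
    case False
    then have arc: "(x, x') \<in> parcs H" using strong_product_arcD(1)[OF that(1)] by blast
    then have "r x \<noteq> r x'"
      using False inj_r H.in_arcsD1 H.in_arcsD2 by (metis inj_on_def)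
    then show ?thesis using E_nbr[OF arc] that by simp
  qed simp
  have arc_less: "\<phi> u \<noteq> \<phi> v" if arc: "(u, v) \<in> parcs ?G" and less: "\<rho> u < \<rho> v" for u v
  proof -
    obtain x y x' y' where uv: "v = (x, y)" "u = (x', y')" by (cases u, cases v)
    have verts: "u \<in> pverts ?G" "v \<in> pverts ?G" using arc G.in_arcsD1 G.in_arcsD2 by blast+
    have arc': "((x, y), (x', y')) \<in> parcs ?G" using symG arc uv by blast
    have "r x' \<le> r x" using \<rho>_less[OF verts] less uv by auto
    then have "x' \<in> ?X x" using nbr_X[OF arc'] by blast
    moreover have "y' \<in> ?N2 y"
      using strong_product_arcD(2)[OF arc'] by (auto simp: closed_nbhd_def)
    moreover have "u \<noteq> v" using less by auto
    ultimately have "u \<in> F v" by (simp add: F_def uv)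
    then show ?thesis using \<phi>_F verts less by blast
  qed
  have "proper_coloring ?G \<phi>"
    unfolding proper_coloring_def
  proof clarsimp
    fix x y x' y' assume arc: "((x, y), (x', y')) \<in> parcs ?G" and eq: "\<phi> (x, y) = \<phi> (x', y')"
    have "(x, y) \<noteq> (x', y')" using G.pair_no_loops[OF arc] by simp
    then show False
      using \<rho>_neq arc_less[OF arc] arc_less[OF symG[OF arc]] eq arc G.in_arcsD1 G.in_arcsD2
      by metis
  qed
  moreover have "conflict_free ?G \<phi>"
    unfolding conflict_free_def
  proof (intro ballI impI)
    fix u assume "u \<in> pverts ?G" "nbhd ?G u \<noteq> {}"
    then obtain v0 where v0: "v0 \<in> nbhd ?G u" by blast
    have neq: "\<phi> v \<noteq> \<phi> (s u)" if v: "v \<in> nbhd ?G u" "v \<noteq> s u" for v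
    proof -
      obtain x y x' y' m z where uvs: "v = (x, y)" "u = (x', y')" "s u = (m, z)"
        by (cases u, cases v, cases "s u")
      have arc: "((x', y'), (x, y)) \<in> parcs ?G" using v uvs by simp
      have arc_s: "((x', y'), (m, z)) \<in> parcs ?G" using s(1)[OF v(1)] uvs by simp
      have verts: "v \<in> pverts ?G" "s u \<in> pverts ?G" and x': "x' \<in> pverts H"
        using arc arc_s G.in_arcsD1 G.in_arcsD2 uvs verts_G by auto
      \<comment> \<open>\<open>s u\<close> is always the earlier of the two, so the constraint is
        met when \<open>v\<close> is coloured.\<close>
      have less: "\<rho> (s u) < \<rho> v"
        using s(2)[OF v(1)] \<rho>_neq[OF verts] v(2) by auto
      then have m_le: "r m \<le> r x" using \<rho>_less[OF verts(2,1)] uvs by auto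
      have y': "y' \<in> closed_nbhd Q y" using strong_product_arcD(2)[OF symG[OF arc]] .
      have "s u \<in> F v"
      proof (cases "r x' \<le> r x")
        \<comment> \<open>\<open>u\<close> lies in the product whose image under \<open>s\<close> is
          the second part of \<open>F v\<close>; \<open>u\<close> itself may come before or after
          \<open>v\<close>.\<close>
        case True
        then have "x' \<in> ?X x" using nbr_X[OF symG[OF arc]] by blast
        moreover have "u \<noteq> v" using G.pair_no_loops[OF arc] uvs by simp
        ultimately have "u \<in> ?X (fst v) \<times> closed_nbhd Q (snd v) - {v}"
          using y' by (simp add: uvs)
        then show ?thesis unfolding F_def by (intro UnI2 imageI)
      next
        \<comment> \<open>Now \<open>x\<close> and \<open>m\<close> are both smaller than
          \<open>x'\<close>, so \<open>E_trans\<close> relates them, while \<open>z\<close> is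
          within distance 2 of \<open>y\<close> through \<open>y'\<close>. Hence \<open>s u\<close>
          is in the first part of \<open>F v\<close>.\<close>
        case False
        then have xE: "x \<in> E x'" and mE: "m \<in> E x'"
          using nbr_X[OF arc] nbr_X[OF arc_s] m_le by auto
        have "m \<in> ?X x"
        proof (cases "m = x")
          case False
          moreover have "m \<in> pverts H" "x \<in> pverts H" using verts by (simp_all add: uvs(1,3) verts_G)
          ultimately have "r m \<noteq> r x" using inj_onD[OF inj_r] by blast
          then show ?thesis using E_trans[OF x' xE mE] m_le by simp
        qed simp
        moreover have "z \<in> ?N2 y"
          using y' strong_product_arcD(2)[OF arc_s] by blast
        ultimately have "s u \<in> ?X (fst v) \<times> ?N2 (snd v)"
          unfolding uvs(1,3) fst_conv snd_conv by (rule SigmaI)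
        then show ?thesis unfolding F_def using v(2) by (intro UnI1) simp
      qed
      then show ?thesis using \<phi>_F verts less by metis
    qed
    show "\<exists>c. \<exists>!v. v \<in> nbhd ?G u \<and> \<phi> v = c"
      using s(1)[OF v0] neq by (intro exI[of _ "\<phi> (s u)"] ex1I[of _ "s u"]) auto
  qed
  ultimately show "\<exists>\<phi>. proper_coloring ?G \<phi> \<and> (\<forall>v \<in> pverts ?G. \<phi> v \<in> L v) \<and> conflict_free ?G \<phi>"
    using \<phi>_L by blast
qed

end
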